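(* For all real $s,t$ with $3<s<t$, let $\mathcal{A}(s,t)$ be the set of $\alpha\in[s,t]$ such that the equation $x+y=z$ has infinitely many solutions $(x,y,z)\in\mathrm{PS}(\alpha)^3$. Then $\dim_{\mathrm{H}}\mathcal{A}(s,t)\le 3/s$. In addition, for almost every $\alpha>3$ (with respect to Lebesgue measure), the equation $x+y=z$ has at most finitely many solutions $(x,y,z)\in\mathrm{PS}(\alpha)^3$.
   Context: For real $\alpha>1$, $\mathrm{PS}(\alpha)=\{\lfloor n^\alpha\rfloor : n\in\mathbb{N}\}$, where $\lfloor x\rfloor$ is the integer part of $x$. $\dim_{\mathrm{H}}$ denotes Hausdorff dimension. (All solutions of $x+y=z$ are regarded as non-trivial.) *)

theory Defs
  imports "HOL-Analysis.Analysis"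
begin

(* The index starts at 1: with 0 in the set, x + 0 = x would always give infinitely many solutions. *)
definition PS :: "real \<Rightarrow> int set" where
  "PS \<alpha> = {\<lfloor>real n powr \<alpha>\<rfloor> | n :: nat. 1 \<le> n}"

(* |U|^d with the usual conventions |{}|^d = 0 and |U|^0 = 1 for nonempty U;
   the case d = 0 is separate because 0 powr 0 = 0 in the library. *)
definition diam_pow :: "real \<Rightarrow> 'a::metric_space set \<Rightarrow> ennreal" where
  "diam_pow d U =
    (if U = {} then 0 else if d = 0 then 1 else ennreal (diameter U powr d))"

(* Covers may contain empty sets, so finite covers are included.  Boundedness is required
   because diameter is unspecified on unbounded sets. *)
definition hausdorff_premeasure :: "real \<Rightarrow> real \<Rightarrow> 'a::metric_space set \<Rightarrow> ennreal" where
  "hausdorff_premeasure d \<delta> A =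
    (INF U \<in> {U :: nat \<Rightarrow> 'a set.
        A \<subseteq> (\<Union>i. U i) \<and> (\<forall>i. bounded (U i) \<and> diameter (U i) \<le> \<delta>)}.
      \<Sum>i. diam_pow d (U i))"

definition hausdorff_outer_measure :: "real \<Rightarrow> 'a::metric_space set \<Rightarrow> ennreal" where
  "hausdorff_outer_measure d A = (SUP \<delta> \<in> {0<..}. hausdorff_premeasure d \<delta> A)"

definition hausdorff_dim :: "'a::metric_space set \<Rightarrow> ennreal" where
  "hausdorff_dim A = (INF d \<in> {d. 0 \<le> d \<and> hausdorff_outer_measure d A = 0}. ennreal d)"

end

theory Submission
  imports Defs
begin

text \<open>
  A solution \<open>\<lfloor>l\<^sup>\<alpha>\<rfloor> + \<lfloor>m\<^sup>\<alpha>\<rfloor> = \<lfloor>n\<^sup>\<alpha>\<rfloor>\<close> forces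
  \<open>\<bar>n\<^sup>\<alpha> - l\<^sup>\<alpha> - m\<^sup>\<alpha>\<bar> < 2\<close>, and we may take \<open>l \<le> m < n\<close>. For fixed \<open>l, m, n\<close>
  the function \<open>(l/n)\<^sup>\<alpha> + (m/n)\<^sup>\<alpha>\<close> is within \<open>2 n\<^sup>-\<^sup>s\<close> of \<open>1\<close> for such
  \<open>\<alpha> \<ge> s\<close>; its larger term is then at least \<open>3/8\<close>, so it decreases at rate at least
  \<open>3/8 (1 - m/n)\<close>, and the admissible \<open>\<alpha>\<close> form a set of diameter
  \<open>O(n\<^sup>1\<^sup>-\<^sup>s / (n - m))\<close>. For \<open>3/s < d < 1\<close> the \<open>d\<close>-th powers of these diameters, summed over
  \<open>l, m < n\<close>, are \<open>O(n\<^sup>2\<^sup>-\<^sup>s\<^sup>d)\<close>, which is summable in \<open>n\<close>. Hence the limsup set has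
  vanishing \<open>d\<close>-dimensional Hausdorff measure, and as \<open>d < 1\<close> it is also Lebesgue null.
\<close>

section \<open>Hausdorff measure: limsup sets and comparison with Lebesgue measure\<close>

lemma diameter_le_metric:
  fixes S :: "'a::metric_space set"
  assumes "0 \<le> r" and "\<And>x y. x \<in> S \<Longrightarrow> y \<in> S \<Longrightarrow> dist x y \<le> r"
  shows "diameter S \<le> r"
  using assms by (auto simp: diameter_def intro!: cSUP_least)

lemma bounded_dist_le:
  assumes "\<And>x y. x \<in> S \<Longrightarrow> y \<in> S \<Longrightarrow> dist x y \<le> r"
  shows "bounded S"
  using assms unfolding bounded_def by blast

lemma diam_pow_le:
  fixes U :: "'a::metric_space set"
  assumes "0 < d" "0 \<le> r" and "\<And>x y. x \<in> U \<Longrightarrow> y \<in> U \<Longrightarrow> dist x y \<le> r"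
  shows "diam_pow d U \<le> ennreal (r powr d)"
proof -
  have "diameter U \<le> r"
    using diameter_le_metric[OF assms(2,3)] .
  moreover have "0 \<le> diameter U"
    using bounded_dist_le[OF assms(3)] by (rule diameter_ge_0)
  ultimately show ?thesis
    using assms(1) by (auto simp: diam_pow_def intro!: ennreal_leI powr_mono2)
qed

lemma hausdorff_premeasure_le_suminf:
  assumes "A \<subseteq> (\<Union>i. U i)" and "\<And>i. bounded (U i)" and "\<And>i. diameter (U i) \<le> \<delta>"
  shows "hausdorff_premeasure d \<delta> A \<le> (\<Sum>i. diam_pow d (U i))"
  unfolding hausdorff_premeasure_def by (rule INF_lower) (use assms in auto)

text \<open>The convergence half of Borel-Cantelli for Hausdorff measure: for every \<open>N\<close>
  the sets \<open>E n i\<close> with \<open>n \<ge> N\<close> cover \<open>A\<close>, and the tails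
  of the convergent series bound the cost of these covers.\<close>

lemma hausdorff_outer_measure_limsup_eq_0:
  fixes E :: "nat \<Rightarrow> 'i \<Rightarrow> 'a::metric_space set"
  assumes d: "0 < d"
    and fin: "\<And>n. finite (I n)"
    and r: "\<And>n i. 0 \<le> r n i"
    and E: "\<And>n i x y. i \<in> I n \<Longrightarrow> x \<in> E n i \<Longrightarrow> y \<in> E n i \<Longrightarrow> dist x y \<le> r n i"
    and sm: "summable (\<lambda>n. \<Sum>i\<in>I n. r n i powr d)"
    and A: "\<And>x N. x \<in> A \<Longrightarrow> \<exists>n\<ge>N. \<exists>i\<in>I n. x \<in> E n i"
  shows "hausdorff_outer_measure d A = 0"
proof -
  \<comment> \<open>The summand 0 gives the bound the form that \<open>ennreal_le_epsilon\<close>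
    expects.\<close>
  have premeasure_le: "hausdorff_premeasure d \<delta> A \<le> 0 + ennreal \<epsilon>" if \<delta>: "0 < \<delta>" and \<epsilon>: "0 < \<epsilon>" for \<delta> \<epsilon>
  proof -
    define R where "R n = (\<Sum>i\<in>I n. r n i powr d)" for n
    have R0: "0 \<le> R n" for n
      unfolding R_def by (intro sum_nonneg) auto
    have smR: "summable (\<lambda>n. R (n + N))" for N
      using sm unfolding R_def summable_iff_shift[of "\<lambda>n. \<Sum>i\<in>I n. r n i powr d"] .
    have "summable R"
      using sm unfolding R_def .
    \<comment> \<open>The tail has two tasks: below \<open>\<epsilon>\<close> it bounds the cost of
      the cover, and below \<open>\<delta> powr d\<close> it forces each single \<open>r n i\<close>
      in the tail to be at most \<open>\<delta>\<close>, so that the cover is admissible.\<close>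
    moreover have "0 < min \<epsilon> (\<delta> powr d)"
      using \<delta> \<epsilon> by auto
    ultimately obtain N where "norm (\<Sum>n. R (n + N)) < min \<epsilon> (\<delta> powr d)"
      using suminf_exist_split by blast
    then have N: "(\<Sum>n. R (n + N)) < \<epsilon>" "(\<Sum>n. R (n + N)) < \<delta> powr d"
      by auto
    have "\<exists>e. bij_betw e {0..<card (I n)} (I n)" for n
      using ex_bij_betw_nat_finite[OF fin] .
    then obtain e where e: "\<And>n. bij_betw (e n) {0..<card (I n)} (I n)"
      by metis
    \<comment> \<open>Each finite level is padded with empty sets, which cost nothing;
      \<open>prod_decode\<close> then turns the doubly indexed family into one sequence.\<close>
    define V where "V = (\<lambda>(n, q). if q < card (I (n + N)) then E (n + N) (e (n + N) q) else {})"
    have eI: "e n q \<in> I n" if "q < card (I n)" for n q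
      using bij_betwE[OF e] that by auto
    have r_le: "r (n + N) i \<le> \<delta>" if i: "i \<in> I (n + N)" for n i
    proof -
      have "r (n + N) i powr d \<le> R (n + N)"
        unfolding R_def by (rule member_le_sum) (use i fin in auto)
      also have "\<dots> \<le> (\<Sum>n. R (n + N))"
        using sum_le_suminf[OF smR, of "{n}"] R0 by simp
      also have "\<dots> < \<delta> powr d"
        by (rule N)
      finally have lt: "r (n + N) i powr d < \<delta> powr d" .
      show ?thesis
      proof (rule ccontr)
        assume "\<not> r (n + N) i \<le> \<delta>"
        then have "\<delta> powr d \<le> r (n + N) i powr d"
          using d \<delta> by (intro powr_mono2) auto
        with lt show False by simp
      qed
    qed
    have dV: "dist x y \<le> \<delta>" if "x \<in> V p" "y \<in> V p" for x y p
    proof -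
      obtain n q where p: "p = (n, q)" by (cases p)
      have q: "q < card (I (n + N))" "x \<in> E (n + N) (e (n + N) q)" "y \<in> E (n + N) (e (n + N) q)"
        using that unfolding p V_def by (auto split: if_splits)
      show ?thesis
        using E[OF eI[OF q(1)] q(2,3)] r_le[OF eI[OF q(1)]] by linarith
    qed
    have "hausdorff_premeasure d \<delta> A \<le> (\<Sum>j. diam_pow d (V (prod_decode j)))"
    proof (rule hausdorff_premeasure_le_suminf)
      show "bounded (V (prod_decode j))" for j
        using dV by (rule bounded_dist_le)
      show "diameter (V (prod_decode j)) \<le> \<delta>" for j
        using \<delta> by (intro diameter_le_metric dV) auto
      show "A \<subseteq> (\<Union>j. V (prod_decode j))"
      proof
        fix x assume "x \<in> A"
        then obtain n i where n: "n \<ge> N" "i \<in> I n" "x \<in> E n i"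
          using A by blast
        obtain q where q: "q < card (I n)" "e n q = i"
          using n(2) bij_betw_imp_surj_on[OF e[of n]] by (metis atLeastLessThan_iff imageE)
        have "x \<in> V (prod_decode (prod_encode (n - N, q)))"
          using n q by (simp add: V_def)
        then show "x \<in> (\<Union>j. V (prod_decode j))"
          by blast
      qed
    qed
    also have "\<dots> = (\<Sum>n. \<Sum>q. diam_pow d (V (n, q)))"
      by (rule suminf_ennreal_2dimen[where f = "\<lambda>p. diam_pow d (V p)"]) simp
    also have "\<dots> \<le> (\<Sum>n. ennreal (R (n + N)))"
    proof (intro suminf_le)
      fix n
      have "(\<Sum>q. diam_pow d (V (n, q))) = (\<Sum>q\<in>{0..<card (I (n + N))}. diam_pow d (V (n, q)))"
        by (rule suminf_finite) (auto simp: V_def diam_pow_def)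
      also have "\<dots> \<le> (\<Sum>q\<in>{0..<card (I (n + N))}. ennreal (r (n + N) (e (n + N) q) powr d))"
        using eI by (intro sum_mono diam_pow_le d r) (auto simp: V_def intro!: E)
      also have "\<dots> = (\<Sum>i\<in>I (n + N). ennreal (r (n + N) i powr d))"
        by (rule sum.reindex_bij_betw[OF e])
      also have "\<dots> = ennreal (R (n + N))"
        unfolding R_def by (rule sum_ennreal) auto
      finally show "(\<Sum>q. diam_pow d (V (n, q))) \<le> ennreal (R (n + N))" .
    qed auto
    also have "\<dots> = ennreal (\<Sum>n. R (n + N))"
      by (intro suminf_ennreal2 R0 smR)
    also have "\<dots> \<le> ennreal \<epsilon>"
      using N(1) by (intro ennreal_leI) simp
    finally show ?thesis by simp
  qed
  have "hausdorff_premeasure d \<delta> A \<le> 0" if "0 < \<delta>" for \<delta>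
    by (rule ennreal_le_epsilon) (rule premeasure_le[OF that])
  then have "hausdorff_outer_measure d A \<le> 0"
    unfolding hausdorff_outer_measure_def by (intro SUP_least) simp
  then show ?thesis by simp
qed

lemma hausdorff_outer_measure_mono:
  fixes A B :: "'a::metric_space set"
  assumes "A \<subseteq> B"
  shows "hausdorff_outer_measure d A \<le> hausdorff_outer_measure d B"
  unfolding hausdorff_outer_measure_def hausdorff_premeasure_def
proof (rule SUP_mono', rule INF_superset_mono)
  fix \<delta> :: real
  show "{U :: nat \<Rightarrow> 'a set. B \<subseteq> (\<Union>i. U i) \<and> (\<forall>i. bounded (U i) \<and> diameter (U i) \<le> \<delta>)}
    \<subseteq> {U. A \<subseteq> (\<Union>i. U i) \<and> (\<forall>i. bounded (U i) \<and> diameter (U i) \<le> \<delta>)}"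
    using assms by (intro Collect_mono) (metis subset_trans)
qed simp

text \<open>For sets of diameter at most 1 and \<open>d \<le> 1\<close>, the diameter is at most its
  \<open>d\<close>-th power, so a cheap cover also has small total length.\<close>

lemma hausdorff_outer_measure_0_imp_negligible:
  fixes A :: "real set"
  assumes d: "0 < d" "d \<le> 1" and A: "hausdorff_outer_measure d A = 0"
  shows "negligible A"
  unfolding negligible_outer
proof (intro allI impI)
  fix \<epsilon> :: real assume \<epsilon>: "0 < \<epsilon>"
  have "hausdorff_premeasure d 1 A \<le> hausdorff_outer_measure d A"
    unfolding hausdorff_outer_measure_def by (rule SUP_upper) auto
  \<comment> \<open>Half of \<open>\<epsilon>\<close> suffices because each covering set is enlarged
    below to an interval of twice its diameter.\<close>
  then have "hausdorff_premeasure d 1 A < ennreal (\<epsilon> / 2)"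
    using A \<epsilon> by simp
  then obtain U :: "nat \<Rightarrow> real set" where U: "A \<subseteq> (\<Union>i. U i)"
      "\<And>i. bounded (U i)" "\<And>i. diameter (U i) \<le> 1"
      "(\<Sum>i. diam_pow d (U i)) < ennreal (\<epsilon> / 2)"
    unfolding hausdorff_premeasure_def by (auto simp: INF_less_iff)
  define B where "B i = (if U i = {} then {} else cball (SOME x. x \<in> U i) (diameter (U i)))" for i
  have UB: "U i \<subseteq> B i" for i
  proof
    fix x assume x: "x \<in> U i"
    then have "(SOME x. x \<in> U i) \<in> U i"
      by (rule someI)
    with x U(2) show "x \<in> B i"
      by (auto simp: B_def intro: diameter_bounded_bound)
  qed
  have AB: "A \<subseteq> (\<Union>i. B i)"
    by (rule subset_trans[OF U(1) UN_mono]) (rule order_refl, rule UB)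
  have B: "B i \<in> sets lebesgue" for i
    by (simp add: B_def)
  have eB: "emeasure lebesgue (B i) \<le> 2 * diam_pow d (U i)" for i
  proof (cases "U i = {}")
    case False
    have D: "0 \<le> diameter (U i)"
      using U(2) by (rule diameter_ge_0)
    then have "diameter (U i) \<le> diameter (U i) powr d"
      using powr_mono'[of d 1 "diameter (U i)"] d U(3)[of i] by auto
    moreover have "emeasure lebesgue (B i) = ennreal (2 * diameter (U i))"
      using False D by (simp add: B_def cball_eq_atLeastAtMost)
    ultimately show ?thesis
      using False d by (simp add: diam_pow_def ennreal_mult' mult_left_mono ennreal_leI)
  qed (simp add: B_def)
  have "emeasure lebesgue (\<Union>i. B i) \<le> (\<Sum>i. emeasure lebesgue (B i))"
    using B by (intro emeasure_subadditive_countably) auto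
  also have "\<dots> \<le> (\<Sum>i. 2 * diam_pow d (U i))"
    by (intro suminf_le eB) auto
  also have "\<dots> = 2 * (\<Sum>i. diam_pow d (U i))"
    by simp
  also have "\<dots> < 2 * ennreal (\<epsilon> / 2)"
    using U(4) by (intro ennreal_mult_strict_left_mono) auto
  also have "\<dots> = ennreal \<epsilon>"
    using \<epsilon> by (simp flip: ennreal_numeral ennreal_mult')
  finally have lt: "emeasure lebesgue (\<Union>i. B i) < ennreal \<epsilon>" .
  then have "emeasure lebesgue (\<Union>i. B i) < \<infinity>"
    using less_trans[OF _ ennreal_less_top] by simp
  then have T: "(\<Union>i. B i) \<in> lmeasurable"
    using B by (intro fmeasurableI sets.countable_UN) auto
  moreover have "measure lebesgue (\<Union>i. B i) < \<epsilon>"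
    using lt unfolding emeasure_eq_measure2[OF T] by (simp add: ennreal_less_iff)
  ultimately show "\<exists>T. A \<subseteq> T \<and> T \<in> lmeasurable \<and> measure lebesgue T < \<epsilon>"
    using AB by blast
qed

section \<open>Real estimates: a power sum and the gap between exponents\<close>

text \<open>Comparison with the integral of \<open>x powr - d\<close>: by the mean value theorem
  each term is dominated by an increment of \<open>x powr (1 - d) / (1 - d)\<close>, and the
  increments telescope.\<close>

lemma sum_powr_neg_le:
  fixes d :: real
  assumes "0 < d" "d < 1"
  shows "(\<Sum>k\<in>{1..n}. real k powr - d) \<le> real n powr (1 - d) / (1 - d)"
proof -
  have step: "(1 - d) * real (Suc k) powr - d \<le> real (Suc k) powr (1 - d) - real k powr (1 - d)" for k
  \<comment> \<open>The derivative formula fails at 0, so the first increment is checked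
    directly.\<close>
  proof (cases "k = 0")
    case False
    have "((\<lambda>x. x powr (1 - d)) has_real_derivative (1 - d) * x powr (- d)) (at x)" if "0 < x" for x
      using that by (auto intro!: derivative_eq_intros)
    then obtain z where z: "real k < z" "z < real (Suc k)"
      "real (Suc k) powr (1 - d) - real k powr (1 - d) = (real (Suc k) - real k) * ((1 - d) * z powr - d)"
      using MVT2[of "real k" "real (Suc k)" "\<lambda>x. x powr (1 - d)" "\<lambda>x. (1 - d) * x powr - d"] False
      by auto
    have "real (Suc k) powr - d \<le> z powr - d"
      using z False assms by (intro powr_mono2') auto
    then show ?thesis
      using z(3) assms by simp
  qed (use assms in auto)
  have "(1 - d) * (\<Sum>k\<in>{1..n}. real k powr - d) \<le> real n powr (1 - d)"
  proof (induction n)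
    case (Suc n)
    then show ?case
      using step[of n] by (simp add: distrib_left)
  qed auto
  then show ?thesis
    using assms by (simp add: field_simps)
qed

text \<open>After division by the power of \<open>n\<close>, both exponents make
  \<open>u powr \<gamma> + v powr \<gamma>\<close> nearly 1. Both terms decrease in
  \<open>\<gamma>\<close>, and the decrease of the larger one alone already limits
  \<open>\<beta> - \<alpha>\<close>.\<close>

lemma powr_near_solution_gap:
  fixes s \<alpha> \<beta> :: real and l m n :: nat
  assumes s: "3 < s" "s \<le> \<alpha>" "\<alpha> \<le> \<beta>"
    and lmn: "1 \<le> l" "l \<le> m" "m < n"
    and a: "\<bar>real n powr \<alpha> - real l powr \<alpha> - real m powr \<alpha>\<bar> < 2"
    and b: "\<bar>real n powr \<beta> - real l powr \<beta> - real m powr \<beta>\<bar> < 2"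
  shows "\<beta> - \<alpha> \<le> 32 / 3 * real n powr (1 - s) / real (n - m)"
proof -
  define u v where "u = real l / real n" and "v = real m / real n"
  have n: "2 \<le> n"
    using lmn by linarith
  have uv: "0 < u" "u \<le> v" "v < 1"
    using lmn by (auto simp: u_def v_def divide_right_mono)
  have near: "\<bar>1 - u powr \<gamma> - v powr \<gamma>\<bar> < 2 * real n powr - s"
    if "s \<le> \<gamma>" and g: "\<bar>real n powr \<gamma> - real l powr \<gamma> - real m powr \<gamma>\<bar> < 2" for \<gamma>
  proof -
    have "real n powr \<gamma> * (1 - u powr \<gamma> - v powr \<gamma>) = real n powr \<gamma> - real l powr \<gamma> - real m powr \<gamma>"
      using n by (simp add: u_def v_def powr_divide algebra_simps)
    then have "real n powr \<gamma> * \<bar>1 - u powr \<gamma> - v powr \<gamma>\<bar> < 2"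
      using g by (metis abs_mult abs_of_nonneg powr_ge_zero)
    then have "\<bar>1 - u powr \<gamma> - v powr \<gamma>\<bar> < 2 * real n powr - \<gamma>"
      using n by (simp add: powr_minus field_simps)
    also have "\<dots> \<le> 2 * real n powr - s"
      using that n by (intro mult_left_mono powr_mono) auto
    finally show ?thesis .
  qed
  have na: "\<bar>1 - u powr \<alpha> - v powr \<alpha>\<bar> < 2 * real n powr - s"
    using near a s by auto
  have nb: "\<bar>1 - u powr \<beta> - v powr \<beta>\<bar> < 2 * real n powr - s"
    using near b s by auto
  have "real n powr - s \<le> real n powr - 3"
    using s n by (intro powr_mono) auto
  also have "\<dots> \<le> 2 powr - 3"
    using n by (intro powr_mono2') auto
  also have "\<dots> = 1 / 8"
    by (simp add: powr_minus)
  finally have n8: "real n powr - s \<le> 1 / 8" .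
  have "u powr \<beta> \<le> v powr \<beta>"
    using uv s by (intro powr_mono2) auto
  \<comment> \<open>The two powers sum to more than 1 - 2/8 = 3/4, and the larger one is at least
    half of that.\<close>
  then have vb: "3 / 8 \<le> v powr \<beta>"
    using nb n8 by linarith
  have ua: "u powr \<beta> \<le> u powr \<alpha>"
    using uv s by (intro powr_mono') auto
  \<comment> \<open>A lower bound for the decay of \<open>v powr \<gamma>\<close> without
    derivatives, from \<open>ln v \<le> v - 1\<close> and \<open>1 + x \<le> exp x\<close>.\<close>
  have "1 + (\<beta> - \<alpha>) * (1 - v) \<le> 1 + (\<beta> - \<alpha>) * (- ln v)"
    using ln_le_minus_one[of v] uv s by (intro add_left_mono mult_left_mono) auto
  also have "\<dots> \<le> exp ((\<beta> - \<alpha>) * (- ln v))"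
    by (rule exp_ge_add_one_self)
  also have "\<dots> = v powr (\<alpha> - \<beta>)"
    using uv by (simp add: powr_def algebra_simps)
  finally have "v powr \<beta> * (1 + (\<beta> - \<alpha>) * (1 - v)) \<le> v powr \<beta> * v powr (\<alpha> - \<beta>)"
    by (intro mult_left_mono) auto
  then have "v powr \<beta> * ((\<beta> - \<alpha>) * (1 - v)) \<le> v powr \<alpha> - v powr \<beta>"
    by (simp add: algebra_simps flip: powr_add)
  \<comment> \<open>The two sums of powers differ by less than twice the error, and by
    \<open>ua\<close> the \<open>u\<close>-terms contribute to that difference with the same sign as
    the \<open>v\<close>-terms.\<close>
  also have "\<dots> \<le> 4 * real n powr - s"
    using na nb ua by linarith
  finally have "v powr \<beta> * ((\<beta> - \<alpha>) * (1 - v)) \<le> 4 * real n powr - s" .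
  moreover have "3 / 8 * ((\<beta> - \<alpha>) * (1 - v)) \<le> v powr \<beta> * ((\<beta> - \<alpha>) * (1 - v))"
    using vb uv s by (intro mult_right_mono) auto
  \<comment> \<open>The constant is 4 divided by 3/8.\<close>
  ultimately have "(\<beta> - \<alpha>) * (1 - v) \<le> 32 / 3 * real n powr - s"
    by linarith
  moreover have "1 - v = real (n - m) / real n"
    using lmn by (simp add: v_def of_nat_diff field_simps)
  ultimately have "(\<beta> - \<alpha>) * real (n - m) \<le> 32 / 3 * (real n * real n powr - s)"
    using n by (simp add: field_simps)
  also have "real n * real n powr - s = real n powr (1 - s)"
    using n by (simp add: powr_diff powr_minus field_simps)
  finally show ?thesis
    using lmn by (simp add: field_simps)
qed

section \<open>From solutions to near-solutions in powers\<close>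

definition PS_solutions :: "real \<Rightarrow> (int \<times> int \<times> int) set" where
  "PS_solutions \<alpha> = {(x, y, z). x \<in> PS \<alpha> \<and> y \<in> PS \<alpha> \<and> z \<in> PS \<alpha> \<and> x + y = z}"

text \<open>Taking floors changes \<open>n powr \<alpha> - l powr \<alpha> - m powr \<alpha>\<close>
  by less than 2. All values are at least 1, so \<open>z\<close> exceeds both \<open>x\<close> and
  \<open>y\<close>, and monotonicity carries this over to the indices.\<close>

lemma PS_solutionsE:
  assumes "0 < \<alpha>" and "(x, y, z) \<in> PS_solutions \<alpha>"
  obtains l m n :: nat where "1 \<le> l" "1 \<le> m" "l < n" "m < n"
    "x = \<lfloor>real l powr \<alpha>\<rfloor>" "y = \<lfloor>real m powr \<alpha>\<rfloor>" "z = \<lfloor>real n powr \<alpha>\<rfloor>"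
    "\<bar>real n powr \<alpha> - real l powr \<alpha> - real m powr \<alpha>\<bar> < 2"
proof -
  obtain l m n :: nat where lmn: "1 \<le> l" "1 \<le> m" "1 \<le> n"
    "x = \<lfloor>real l powr \<alpha>\<rfloor>" "y = \<lfloor>real m powr \<alpha>\<rfloor>" "z = \<lfloor>real n powr \<alpha>\<rfloor>" and xyz: "x + y = z"
    using assms(2) unfolding PS_solutions_def PS_def by blast
  have pos: "1 \<le> \<lfloor>real k powr \<alpha>\<rfloor>" if "1 \<le> k" for k :: nat
    using that assms(1) by (simp add: ge_one_powr_ge_zero)
  have less: "k < n" if "\<lfloor>real k powr \<alpha>\<rfloor> < \<lfloor>real n powr \<alpha>\<rfloor>" for k
  proof (rule ccontr)
    assume "\<not> k < n"
    then have "real n powr \<alpha> \<le> real k powr \<alpha>"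
      using assms(1) by (intro powr_mono2) auto
    then show False
      using floor_mono that by fastforce
  qed
  have "l < n" "m < n"
    using pos[OF lmn(1)] pos[OF lmn(2)] lmn(4-6) xyz by (intro less; linarith)+
  moreover have "\<bar>real n powr \<alpha> - real l powr \<alpha> - real m powr \<alpha>\<bar> < 2"
    using lmn xyz by linarith
  ultimately show ?thesis
    using that lmn by blast
qed

text \<open>Indices below \<open>N\<close> produce only finitely many triples of values, so some
  solution has its largest index \<open>n\<close> at least \<open>N\<close>; symmetry in
  \<open>l\<close> and \<open>m\<close> allows ordering them.\<close>

lemma infinite_PS_solutions_imp:
  assumes "0 < \<alpha>" and "infinite (PS_solutions \<alpha>)"
  shows "\<exists>n\<ge>N. \<exists>l m. 1 \<le> l \<and> l \<le> m \<and> m < n \<and>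
    \<bar>real n powr \<alpha> - real l powr \<alpha> - real m powr \<alpha>\<bar> < 2"
proof -
  let ?f = "\<lambda>(l :: nat, m :: nat, n :: nat).
    (\<lfloor>real l powr \<alpha>\<rfloor>, \<lfloor>real m powr \<alpha>\<rfloor>, \<lfloor>real n powr \<alpha>\<rfloor>)"
  have "finite (?f ` ({..<N} \<times> {..<N} \<times> {..<N}))"
    by blast
  then have "\<not> PS_solutions \<alpha> \<subseteq> ?f ` ({..<N} \<times> {..<N} \<times> {..<N})"
    using assms(2) finite_subset by blast
  then obtain x y z where xyz: "(x, y, z) \<in> PS_solutions \<alpha>"
    "(x, y, z) \<notin> ?f ` ({..<N} \<times> {..<N} \<times> {..<N})"
    by auto
  obtain l m n :: nat where lmn: "1 \<le> l" "1 \<le> m" "l < n" "m < n"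
    "x = \<lfloor>real l powr \<alpha>\<rfloor>" "y = \<lfloor>real m powr \<alpha>\<rfloor>" "z = \<lfloor>real n powr \<alpha>\<rfloor>"
    "\<bar>real n powr \<alpha> - real l powr \<alpha> - real m powr \<alpha>\<bar> < 2"
    using PS_solutionsE[OF assms(1) xyz(1)] .
  have "N \<le> n"
  proof (rule ccontr)
    assume "\<not> N \<le> n"
    then have "(l, m, n) \<in> {..<N} \<times> {..<N} \<times> {..<N}"
      using lmn by auto
    then show False
      using xyz(2) lmn(5-7) by force
  qed
  moreover have "\<exists>l' m'. 1 \<le> l' \<and> l' \<le> m' \<and> m' < n \<and>
      \<bar>real n powr \<alpha> - real l' powr \<alpha> - real m' powr \<alpha>\<bar> < 2"
  proof (cases "l \<le> m")
    case True
    then show ?thesis using lmn by blast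
  next
    case False
    then show ?thesis
      using lmn by (intro exI[of _ m] exI[of _ l]) auto
  qed
  ultimately show ?thesis by blast
qed

section \<open>Vanishing Hausdorff measure and its two consequences\<close>

lemma hausdorff_outer_measure_infinite_PS_solutions:
  fixes s d :: real
  assumes s: "3 < s" and d: "3 / s < d" "d < 1"
  shows "hausdorff_outer_measure d {\<alpha>. s \<le> \<alpha> \<and> infinite (PS_solutions \<alpha>)} = 0"
proof -
  \<comment> \<open>The condition \<open>l \<le> m\<close> is placed in \<open>E\<close> rather than
    in \<open>I\<close>, so that the index set is a rectangle and the sum over \<open>l\<close> is
    just a factor \<open>n\<close>.\<close>
  define I :: "nat \<Rightarrow> (nat \<times> nat) set" where "I n = {1..n} \<times> {1..<n}" for n
  define E where "E n = (\<lambda>(l :: nat, m :: nat). {\<alpha> :: real. s \<le> \<alpha> \<and> l \<le> m \<and>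
    \<bar>real n powr \<alpha> - real l powr \<alpha> - real m powr \<alpha>\<bar> < 2})" for n :: nat
  define r where "r n = (\<lambda>(l :: nat, m :: nat). 32 / 3 * real n powr (1 - s) / real (n - m))" for n :: nat
  have d0: "0 < d"
    using s d by (smt (verit) divide_pos_pos)
  show ?thesis
  proof (rule hausdorff_outer_measure_limsup_eq_0[of d I r E])
    show "0 < d" by (rule d0)
    show "finite (I n)" for n
      by (simp add: I_def)
    show "0 \<le> r n i" for n i
      by (simp add: r_def split: prod.split)
    show "dist x y \<le> r n i" if "i \<in> I n" "x \<in> E n i" "y \<in> E n i" for n i x y
    proof -
      obtain l m where i: "i = (l, m)" by (cases i)
      have *: "1 \<le> l" "l \<le> m" "m < n"
        using that by (auto simp: i I_def E_def)
      show ?thesis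
      proof (cases "x \<le> y")
        case True
        then show ?thesis
          using powr_near_solution_gap[OF s _ True *] that by (simp add: i E_def r_def dist_real_def)
      next
        case False
        then have "y \<le> x" by simp
        then show ?thesis
          using powr_near_solution_gap[OF s _ \<open>y \<le> x\<close> *] that by (simp add: i E_def r_def dist_real_def)
      qed
    qed
    define C where "C = (32 / 3) powr d / (1 - d)"
    \<comment> \<open>This is where 3/s arises: \<open>2 - s * d < -1\<close> holds exactly when
      \<open>d > 3 / s\<close>.\<close>
    have "3 < s * d"
      using s d(1) by (simp add: pos_divide_less_eq mult.commute)
    then have "summable (\<lambda>n. C * real n powr (2 - s * d))"
      by (intro summable_mult) (simp add: summable_real_powr_iff)
    then show "summable (\<lambda>n. \<Sum>i\<in>I n. r n i powr d)"
    proof (rule summable_comparison_test'[where N = 1])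
      fix n :: nat assume n: "1 \<le> n"
      define c where "c = (32 / 3 * real n powr (1 - s)) powr d"
      have c_eq: "c = (32 / 3) powr d * real n powr ((1 - s) * d)"
        unfolding c_def powr_powr[symmetric] by (rule powr_mult)
      have powr_quot: "(x / y) powr d = x powr d * y powr - d" if "0 \<le> x" "0 \<le> y" for x y
        using that by (simp add: powr_divide powr_minus_divide)
      have "r n (l, m) powr d = c * real (n - m) powr - d" for l m
        unfolding r_def c_def prod.case by (rule powr_quot) simp_all
      then have "(\<Sum>i\<in>I n. r n i powr d) = (\<Sum>l\<in>{1..n}. \<Sum>m\<in>{1..<n}. c * real (n - m) powr - d)"
        unfolding I_def sum.cartesian_product by (intro sum.cong) auto
      also have "\<dots> = real n * (c * (\<Sum>m\<in>{1..<n}. real (n - m) powr - d))"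
        by (simp add: sum_distrib_left)
      \<comment> \<open>The substitution \<open>k = n - m\<close> brings the sum into the form of
        \<open>sum_powr_neg_le\<close>.\<close>
      also have "(\<Sum>m\<in>{1..<n}. real (n - m) powr - d) = (\<Sum>k\<in>{1..<n}. real k powr - d)"
        by (rule sum.reindex_bij_witness[of _ "\<lambda>k. n - k" "\<lambda>k. n - k"]) auto
      also have "real n * (c * \<dots>) \<le> real n * (c * (real n powr (1 - d) / (1 - d)))"
      proof (intro mult_left_mono)
        have "(\<Sum>k\<in>{1..<n}. real k powr - d) \<le> (\<Sum>k\<in>{1..n}. real k powr - d)"
          by (intro sum_mono2) auto
        also have "\<dots> \<le> real n powr (1 - d) / (1 - d)"
          by (intro sum_powr_neg_le d0 d)
        finally show "(\<Sum>k\<in>{1..<n}. real k powr - d) \<le> real n powr (1 - d) / (1 - d)" .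
      qed (auto simp: c_def)
      \<comment> \<open>The factors come from the choices of \<open>l\<close>, from the common part
        of the diameters, and from the sum over \<open>m\<close>; the exponents add up to
        \<open>2 - s * d\<close>.\<close>
      also have "\<dots> = C * (real n powr 1 * real n powr ((1 - s) * d) * real n powr (1 - d))"
        using n by (simp add: c_eq C_def)
      also have "\<dots> = C * real n powr (2 - s * d)"
        unfolding powr_add[symmetric] by (simp add: algebra_simps)
      finally show "norm (\<Sum>i\<in>I n. r n i powr d) \<le> C * real n powr (2 - s * d)"
        by (simp add: sum_nonneg)
    qed
    show "\<exists>n\<ge>N. \<exists>i\<in>I n. \<alpha> \<in> E n i" if "\<alpha> \<in> {\<alpha>. s \<le> \<alpha> \<and> infinite (PS_solutions \<alpha>)}" for \<alpha> N
    proof -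
      have \<alpha>: "s \<le> \<alpha>" "0 < \<alpha>" "infinite (PS_solutions \<alpha>)"
        using that s by auto
      obtain n l m where *: "N \<le> n" "1 \<le> l" "l \<le> m" "m < n"
        "\<bar>real n powr \<alpha> - real l powr \<alpha> - real m powr \<alpha>\<bar> < 2"
        using infinite_PS_solutions_imp[OF \<alpha>(2,3)] by blast
      then have "(l, m) \<in> I n" "\<alpha> \<in> E n (l, m)"
        using \<alpha> by (auto simp: I_def E_def)
      then show ?thesis
        using *(1) by blast
    qed
  qed
qed

text \<open>Every \<open>d\<close> strictly between 3/s and 1 is admissible in the infimum, and such
  \<open>d\<close> come arbitrarily close to 3/s.\<close>

lemma hausdorff_dim_infinite_PS_solutions:
  fixes s :: real
  assumes s: "3 < s" and A: "A \<subseteq> {\<alpha>. s \<le> \<alpha> \<and> infinite (PS_solutions \<alpha>)}"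
  shows "hausdorff_dim A \<le> ennreal (3 / s)"
proof (rule ennreal_le_epsilon)
  fix e :: real assume e: "0 < e"
  have s1: "0 < 3 / s" "3 / s < 1"
    using s by auto
  have "3 / s < min (3 / s + e) 1"
    using s1 e by simp
  then obtain d where "3 / s < d" "d < min (3 / s + e) 1"
    using dense by blast
  then have d: "3 / s < d" "d < 1" "d \<le> 3 / s + e"
    by simp_all
  have "hausdorff_outer_measure d A = 0"
    using hausdorff_outer_measure_mono[OF A, of d]
      hausdorff_outer_measure_infinite_PS_solutions[OF s d(1,2)] by simp
  moreover have "0 \<le> d"
    using s1(1) d(1) by linarith
  ultimately have "hausdorff_dim A \<le> ennreal d"
    unfolding hausdorff_dim_def by (intro INF_lower) simp
  also have "\<dots> \<le> ennreal (3 / s) + ennreal e"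
    using s1 e d by (simp flip: ennreal_plus add: ennreal_leI)
  finally show "hausdorff_dim A \<le> ennreal (3 / s) + ennreal e" .
qed

text \<open>The measure estimate needs a lower bound \<open>s > 3\<close> on the exponents, so the
  half-line above 3 is exhausted by countably many closed half-lines; on each, some
  \<open>d < 1\<close> makes the exceptional set null.\<close>

lemma AE_finite_PS_solutions: "AE \<alpha> in lebesgue. 3 < \<alpha> \<longrightarrow> finite (PS_solutions \<alpha>)"
proof -
  define A where "A j = {\<alpha>. 3 + inverse (real (Suc j)) \<le> \<alpha> \<and> infinite (PS_solutions \<alpha>)}" for j
  have "negligible (A j)" for j
  proof -
    define s where "s = 3 + inverse (real (Suc j))"
    have s: "3 < s"
      by (simp add: s_def)
    then have s1: "0 < 3 / s" "3 / s < 1"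
      by auto
    then obtain d where d: "3 / s < d" "d < 1"
      using dense by blast
    show ?thesis
      using hausdorff_outer_measure_0_imp_negligible[of d "A j"]
        hausdorff_outer_measure_infinite_PS_solutions[OF s d] s1 d
      by (simp add: A_def s_def)
  qed
  then have "(\<Union>j. A j) \<in> null_sets lebesgue"
    unfolding negligible_iff_null_sets[symmetric] by (intro negligible_countable_Union) auto
  moreover have "{\<alpha> \<in> space lebesgue. \<not> (3 < \<alpha> \<longrightarrow> finite (PS_solutions \<alpha>))} \<subseteq> (\<Union>j. A j)"
  proof
    fix \<alpha> :: real assume "\<alpha> \<in> {\<alpha> \<in> space lebesgue. \<not> (3 < \<alpha> \<longrightarrow> finite (PS_solutions \<alpha>))}"
    then have \<alpha>: "0 < \<alpha> - 3" "infinite (PS_solutions \<alpha>)"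
      by auto
    obtain j where "inverse (real (Suc j)) < \<alpha> - 3"
      using reals_Archimedean[OF \<alpha>(1)] by auto
    then have "\<alpha> \<in> A j"
      using \<alpha> by (simp add: A_def)
    then show "\<alpha> \<in> (\<Union>j. A j)"
      by blast
  qed
  ultimately show ?thesis
    by (rule AE_I')
qed

theorem theorem3p1:
  shows "(\<forall>s t :: real. 3 < s \<and> s < t \<longrightarrow>
            hausdorff_dim {\<alpha> \<in> {s..t}.
              infinite {(x, y, z). x \<in> PS \<alpha> \<and> y \<in> PS \<alpha> \<and> z \<in> PS \<alpha> \<and> x + y = z}}
            \<le> ennreal (3 / s))
       \<and> (AE \<alpha> in lebesgue. 3 < \<alpha> \<longrightarrow>
            finite {(x, y, z). x \<in> PS \<alpha> \<and> y \<in> PS \<alpha> \<and> z \<in> PS \<alpha> \<and> x + y = z})"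
  unfolding PS_solutions_def[symmetric]
  using AE_finite_PS_solutions by (auto intro!: hausdorff_dim_infinite_PS_solutions)

end
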